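(* Let $\mathcal{M}=\mathcal{M}(\Sigma,I)$ be a trace monoid acting partially on a finite set $X_0$, with associated total action on $X_0\cup\{\bot\}$. Define the square matrices indexed by $X_0\times X_0$ with entries in $\mathbb{Z}[[t]]$: $Z_{\alpha,\beta}(t)=\sum_{x\in\mathcal{M}_{\alpha,\beta}}t^{|x|}$ and $\mu_{\alpha,\beta}(t)=\sum_{\gamma\in\mathscr{C}\cap\mathcal{M}_{\alpha,\beta}}(-1)^{|\gamma|}t^{|\gamma|}$. Then $\mu(t)Z(t)=Z(t)\mu(t)=I$ in the algebra of $X_0\times X_0$ matrices over $\mathbb{Z}[[t]]$, where $I_{\alpha,\beta}=\mathbf{1}_{\{\alpha=\beta\}}$.
   Context: Trace monoid: $\Sigma$ finite, $|\Sigma|\ge2$, $I$ irreflexive symmetric relation on $\Sigma$, $\mathcal{M}=\Sigma^*/\langle ab=ba,\ (a,b)\in I\rangle$, unit $1$, length $|x|$. Cliques: traces $a_1\cdots a_k$ ($k\ge0$) of pairwise distinct letters pairwise in $I$; $\mathscr{C}$ the set of cliques; $c\parallel c'$ if $c\cdot c'$ is a clique. A partial action: nonempty $\Sigma(\alpha)\subseteq\Sigma$ for $\alpha\in X_0$ and maps $a\in\Sigma(\alpha)\mapsto\alpha\cdot a\in X_0$ such that if $a\in\Sigma(\alpha)$ and $a\parallel b$, then either $b\in\Sigma(\alpha)$ and $a\in\Sigma(\alpha\cdot b)$, $b\in\Sigma(\alpha\cdot a)$, $(\alpha\cdot a)\cdot b=(\alpha\cdot b)\cdot a$; or $b\notin\Sigma(\alpha)$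 and $b\notin\Sigma(\alpha\cdot a)$. The associated total action is the unique right action of $\mathcal{M}$ on $X_0\cup\{\bot\}$ extending these maps with $\alpha\cdot a=\bot$ for $a\notin\Sigma(\alpha)$ and $\bot\cdot a=\bot$. $\mathcal{M}_{\alpha,\beta}=\{x\in\mathcal{M}:\alpha\cdot x=\beta\}$ for $\alpha,\beta\in X_0$. *)

theory Defs
  imports
    "HOL-Analysis.Analysis"
    "HOL-Computational_Algebra.Formal_Power_Series"
    "HOL-Algebra.Group"
begin

section \<open>Trace monoids\<close>

inductive_set trace_cong :: "('a \<times> 'a) set \<Rightarrow> ('a list \<times> 'a list) set"
  for I :: "('a \<times> 'a) set" where
  commute: "(a, b) \<in> I \<Longrightarrow> ([a, b], [b, a]) \<in> trace_cong I"
| refl: "(u, u) \<in> trace_cong I"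
| sym: "(u, v) \<in> trace_cong I \<Longrightarrow> (v, u) \<in> trace_cong I"
| trans: "(u, v) \<in> trace_cong I \<Longrightarrow> (v, w) \<in> trace_cong I \<Longrightarrow> (u, w) \<in> trace_cong I"
| append: "(u, v) \<in> trace_cong I \<Longrightarrow> (u', v') \<in> trace_cong I \<Longrightarrow> (u @ u', v @ v') \<in> trace_cong I"

definition trace_of :: "('a \<times> 'a) set \<Rightarrow> 'a list \<Rightarrow> 'a list set" where
  "trace_of I w = trace_cong I `` {w}"

text \<open>The alphabet is the whole type \<^typ>\<open>'a\<close>, so every word represents a trace.\<close>

definition trace_monoid :: "('a \<times> 'a) set \<Rightarrow> 'a list set monoid" where
  "trace_monoid I =
     \<lparr>carrier = UNIV // trace_cong I,
      monoid.mult = (\<lambda>x y. \<Union>u\<in>x. \<Union>v\<in>y. trace_of I (u @ v)),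
      one = trace_of I []\<rparr>"

text \<open>Congruent words have the same length, so on traces the set below is a singleton.\<close>

definition trace_length :: "'a list set \<Rightarrow> nat" where
  "trace_length x = the_elem (length ` x)"

definition cliques :: "('a \<times> 'a) set \<Rightarrow> 'a list set set" where
  "cliques I = {trace_of I w |w. distinct w \<and>
     (\<forall>a\<in>set w. \<forall>b\<in>set w. a \<noteq> b \<longrightarrow> (a, b) \<in> I)}"

definition parallel :: "('a \<times> 'a) set \<Rightarrow> 'a list set \<Rightarrow> 'a list set \<Rightarrow> bool" where
  "parallel I c c' \<longleftrightarrow> c \<otimes>\<^bsub>trace_monoid I\<^esub> c' \<in> cliques I"

section \<open>Partial actions and the associated total action\<close>

text \<open>\<open>En \<alpha>\<close> is the set of letters enabled at \<open>\<alpha>\<close>; the value \<open>act \<alpha> a\<close> is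
  meaningful only for \<open>a \<in> En \<alpha>\<close> and is otherwise ignored.\<close>

definition partial_action ::
    "('a \<times> 'a) set \<Rightarrow> ('x \<Rightarrow> 'a set) \<Rightarrow> ('x \<Rightarrow> 'a \<Rightarrow> 'x) \<Rightarrow> bool" where
  "partial_action I En act \<longleftrightarrow>
     (\<forall>\<alpha>. En \<alpha> \<noteq> {}) \<and>
     (\<forall>\<alpha> a b. a \<in> En \<alpha> \<and> parallel I (trace_of I [a]) (trace_of I [b]) \<longrightarrow>
        (b \<in> En \<alpha> \<and> a \<in> En (act \<alpha> b) \<and> b \<in> En (act \<alpha> a) \<and>
           act (act \<alpha> a) b = act (act \<alpha> b) a) \<or>
        (b \<notin> En \<alpha> \<and> b \<notin> En (act \<alpha> a)))"

definition total_step ::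
    "('x \<Rightarrow> 'a set) \<Rightarrow> ('x \<Rightarrow> 'a \<Rightarrow> 'x) \<Rightarrow> 'x option \<Rightarrow> 'a \<Rightarrow> 'x option" where
  "total_step En act \<xi> a =
     (case \<xi> of None \<Rightarrow> None | Some \<alpha> \<Rightarrow> if a \<in> En \<alpha> then Some (act \<alpha> a) else None)"

text \<open>The point \<open>\<bottom>\<close> is \<^const>\<open>None\<close>. For a partial action, all representatives of a trace
  act in the same way, and this is the unique right action of the trace monoid extending
  \<^const>\<open>total_step\<close>: see \<open>total_action_right_action\<close> and \<open>total_action_unique\<close> below.\<close>

definition total_action ::
    "('x \<Rightarrow> 'a set) \<Rightarrow> ('x \<Rightarrow> 'a \<Rightarrow> 'x) \<Rightarrow> 'x option \<Rightarrow> 'a list set \<Rightarrow> 'x option" where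
  "total_action En act \<xi> x = the_elem (foldl (total_step En act) \<xi> ` x)"

definition traces_between ::
    "('a \<times> 'a) set \<Rightarrow> ('x \<Rightarrow> 'a set) \<Rightarrow> ('x \<Rightarrow> 'a \<Rightarrow> 'x) \<Rightarrow> 'x \<Rightarrow> 'x \<Rightarrow> 'a list set set" where
  "traces_between I En act \<alpha> \<beta> =
     {x \<in> carrier (trace_monoid I). total_action En act (Some \<alpha>) x = Some \<beta>}"

section \<open>Growth and Moebius matrices\<close>

text \<open>The infinite sum is taken in the \<open>t\<close>-adic topology on formal power series; it converges,
  see \<open>growth_series_has_sum\<close> below.\<close>

definition growth_matrix ::
    "('a \<times> 'a) set \<Rightarrow> ('x \<Rightarrow> 'a set) \<Rightarrow> ('x \<Rightarrow> 'a \<Rightarrow> 'x) \<Rightarrow> int fps ^ 'x ^ 'x" where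
  "growth_matrix I En act =
     (\<chi> \<alpha> \<beta>. \<Sum>\<^sub>\<infinity>x\<in>traces_between I En act \<alpha> \<beta>. fps_X ^ trace_length x)"

definition moebius_matrix ::
    "('a \<times> 'a) set \<Rightarrow> ('x \<Rightarrow> 'a set) \<Rightarrow> ('x \<Rightarrow> 'a \<Rightarrow> 'x) \<Rightarrow> int fps ^ 'x ^ 'x" where
  "moebius_matrix I En act =
     (\<chi> \<alpha> \<beta>. \<Sum>c\<in>cliques I \<inter> traces_between I En act \<alpha> \<beta>.
        (- 1) ^ trace_length c * fps_X ^ trace_length c)"

section \<open>Well-definedness\<close>

lemma equiv_trace_cong: "equiv UNIV (trace_cong I)"
proof (rule equivI)
  show "refl (trace_cong I)" by (rule reflI) (rule trace_cong.refl)
  show "sym (trace_cong I)" by (rule symI) (rule trace_cong.sym)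
  show "trans (trace_cong I)" by (rule transI) (rule trace_cong.trans)
qed simp

lemma trace_of_eq_iff: "trace_of I u = trace_of I v \<longleftrightarrow> (u, v) \<in> trace_cong I"
  using eq_equiv_class_iff[OF equiv_trace_cong] by (auto simp: trace_of_def)

lemma mem_trace_of: "v \<in> trace_of I u \<longleftrightarrow> (u, v) \<in> trace_cong I"
  by (auto simp: trace_of_def)

lemma carrier_trace_monoid: "carrier (trace_monoid I) = range (trace_of I)"
  by (auto simp: trace_monoid_def quotient_def trace_of_def)

lemma one_trace_monoid: "\<one>\<^bsub>trace_monoid I\<^esub> = trace_of I []"
  by (simp add: trace_monoid_def)

lemma mult_trace_of:
  "trace_of I u \<otimes>\<^bsub>trace_monoid I\<^esub> trace_of I v = trace_of I (u @ v)"
proof -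
  have eq: "trace_of I (u' @ v') = trace_of I (u @ v)"
    if "u' \<in> trace_of I u" "v' \<in> trace_of I v" for u' v'
    using that trace_cong.append[of u u' I v v', THEN trace_cong.sym]
    by (simp add: trace_of_eq_iff mem_trace_of)
  have ne: "trace_of I w \<noteq> {}" for w
    using trace_cong.refl[of w I] by (auto simp: trace_of_def)
  have "(\<Union>u'\<in>trace_of I u. \<Union>v'\<in>trace_of I v. trace_of I (u' @ v')) =
      (\<Union>u'\<in>trace_of I u. \<Union>v'\<in>trace_of I v. trace_of I (u @ v))"
    by (intro SUP_cong HOL.refl eq)
  then show ?thesis
    by (simp add: trace_monoid_def ne)
qed

lemma monoid_trace_monoid: "monoid (trace_monoid I)"
  by (rule monoidI) (auto simp: carrier_trace_monoid mult_trace_of one_trace_monoid)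

lemma trace_cong_mset: "(u, v) \<in> trace_cong I \<Longrightarrow> mset u = mset v"
  by (induction rule: trace_cong.induct) auto

lemma trace_length_trace_of: "trace_length (trace_of I w) = length w"
proof -
  have "length ` trace_of I w = {length w}"
  proof
    show "length ` trace_of I w \<subseteq> {length w}"
      using trace_cong_mset[THEN mset_eq_length] by (force simp: mem_trace_of)
    show "{length w} \<subseteq> length ` trace_of I w"
      using trace_cong.refl[of w I] by (simp add: mem_trace_of)
  qed
  then show ?thesis by (simp add: trace_length_def)
qed

lemma parallel_letters_iff:
  assumes "irrefl I" "sym I"
  shows "parallel I (trace_of I [a]) (trace_of I [b]) \<longleftrightarrow> (a, b) \<in> I"
proof
  assume "parallel I (trace_of I [a]) (trace_of I [b])"
  then obtain w where w: "([a, b], w) \<in> trace_cong I" "distinct w"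
      "\<forall>a\<in>set w. \<forall>b\<in>set w. a \<noteq> b \<longrightarrow> (a, b) \<in> I"
    by (auto simp: parallel_def mult_trace_of cliques_def trace_of_eq_iff)
  from trace_cong_mset[OF w(1)] have m: "mset w = mset [a, b]" by simp
  have "set w = {a, b}"
    using mset_eq_setD[OF m] by simp
  moreover have "distinct [a, b]"
    using w(2) mset_eq_imp_distinct_iff[OF m] by blast
  ultimately have "a \<in> set w" "b \<in> set w" "a \<noteq> b"
    by simp_all
  with w(3) show "(a, b) \<in> I" by blast
next
  assume "(a, b) \<in> I"
  then have "distinct [a, b] \<and> (\<forall>c\<in>set [a, b]. \<forall>d\<in>set [a, b]. c \<noteq> d \<longrightarrow> (c, d) \<in> I)"
    using assms by (auto simp: irrefl_def dest: symD)
  then show "parallel I (trace_of I [a]) (trace_of I [b])"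
    unfolding parallel_def cliques_def mult_trace_of append.simps by blast
qed

lemma total_action_trace_of:
  assumes "irrefl I" "sym I" "partial_action I En act"
  shows "total_action En act \<xi> (trace_of I w) = foldl (total_step En act) \<xi> w"
proof -
  have "foldl (total_step En act) \<zeta> u = foldl (total_step En act) \<zeta> v"
    if "(u, v) \<in> trace_cong I" for u v \<zeta>
    using that
  proof (induction arbitrary: \<zeta> rule: trace_cong.induct)
    case (commute a b)
    then have "parallel I (trace_of I [a]) (trace_of I [b])"
      "parallel I (trace_of I [b]) (trace_of I [a])"
      using assms(1,2) by (auto simp: parallel_letters_iff dest: symD)
    then show ?case
      using assms(3) unfolding partial_action_def
      by (cases \<zeta>) (simp_all add: total_step_def, metis)
  qed simp_all
  then have "foldl (total_step En act) \<xi> v = foldl (total_step En act) \<xi> w"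
    if "v \<in> trace_of I w" for v
    using that by (metis mem_trace_of)
  then have "foldl (total_step En act) \<xi> ` trace_of I w = (\<lambda>_. foldl (total_step En act) \<xi> w) ` trace_of I w"
    by (rule image_cong[OF HOL.refl])
  also have "\<dots> = {foldl (total_step En act) \<xi> w}"
    using trace_cong.refl[of w I] by (auto simp: mem_trace_of)
  finally show ?thesis by (simp add: total_action_def)
qed

lemma total_action_right_action:
  assumes "irrefl I" "sym I" "partial_action I En act"
  shows "total_action En act \<xi> \<one>\<^bsub>trace_monoid I\<^esub> = \<xi>"
    and "x \<in> carrier (trace_monoid I) \<Longrightarrow> y \<in> carrier (trace_monoid I) \<Longrightarrow>
      total_action En act \<xi> (x \<otimes>\<^bsub>trace_monoid I\<^esub> y) =
      total_action En act (total_action En act \<xi> x) y"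
    and "total_action En act \<xi> (trace_of I [a]) = total_step En act \<xi> a"
  by (auto simp: carrier_trace_monoid mult_trace_of one_trace_monoid
      total_action_trace_of[OF assms])

lemma total_action_unique:
  assumes "irrefl I" "sym I" "partial_action I En act"
    and one: "\<And>\<xi>. T \<xi> \<one>\<^bsub>trace_monoid I\<^esub> = \<xi>"
    and mult: "\<And>\<xi> x y. x \<in> carrier (trace_monoid I) \<Longrightarrow> y \<in> carrier (trace_monoid I) \<Longrightarrow>
      T \<xi> (x \<otimes>\<^bsub>trace_monoid I\<^esub> y) = T (T \<xi> x) y"
    and letter: "\<And>\<xi> a. T \<xi> (trace_of I [a]) = total_step En act \<xi> a"
    and "x \<in> carrier (trace_monoid I)"
  shows "T \<xi> x = total_action En act \<xi> x"
proof -
  have "T \<xi> (trace_of I w) = foldl (total_step En act) \<xi> w" for w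
  proof (induction w arbitrary: \<xi>)
    case Nil
    then show ?case using one by (simp add: one_trace_monoid)
  next
    case (Cons a w)
    have "T \<xi> (trace_of I (a # w)) = T (T \<xi> (trace_of I [a])) (trace_of I w)"
      using mult[of "trace_of I [a]" "trace_of I w"]
      by (simp add: mult_trace_of carrier_trace_monoid)
    then show ?case by (simp add: letter Cons.IH)
  qed
  then show ?thesis
    using assms(7) by (auto simp: carrier_trace_monoid total_action_trace_of[OF assms(1-3)])
qed

lemma finite_cliques: "finite (cliques (I :: ('a::finite \<times> 'a) set))"
proof -
  have "finite {w :: 'a list. distinct w}"
    using finite_subset_distinct[of "UNIV :: 'a set"] by simp
  moreover have "cliques I \<subseteq> trace_of I ` {w. distinct w}"
    by (auto simp: cliques_def)
  ultimately show ?thesis by (meson finite_imageI finite_subset)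
qed

lemma finite_traces_of_length:
  "finite {x \<in> carrier (trace_monoid (I :: ('a::finite \<times> 'a) set)). trace_length x = n}"
proof -
  have "finite {w :: 'a list. length w = n}"
    using finite_lists_length_eq[of "UNIV :: 'a set" n] by simp
  moreover have "{x \<in> carrier (trace_monoid I). trace_length x = n} \<subseteq> trace_of I ` {w. length w = n}"
    by (auto simp: carrier_trace_monoid trace_length_trace_of)
  ultimately show ?thesis by (meson finite_imageI finite_subset)
qed

lemma growth_series_has_sum:
  fixes I :: "('a::finite \<times> 'a) set"
  shows "((\<lambda>x. fps_X ^ trace_length x) has_sum
     Abs_fps (\<lambda>n. int (card {x \<in> traces_between I En act \<alpha> \<beta>. trace_length x = n})))
     (traces_between I En act \<alpha> \<beta>)" (is "(?f has_sum ?S) ?M")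
proof -
  have fin: "finite {x \<in> ?M. trace_length x \<le> n}" for n
  proof -
    have "{x \<in> ?M. trace_length x \<le> n} \<subseteq>
        (\<Union>k\<le>n. {x \<in> carrier (trace_monoid I). trace_length x = k})"
      by (auto simp: traces_between_def)
    then show ?thesis
      by (rule finite_subset) (auto intro: finite_traces_of_length)
  qed
  have "(sum ?f \<longlongrightarrow> ?S) (finite_subsets_at_top ?M)"
  proof (rule tendsto_fpsI)
    fix n
    show "\<forall>\<^sub>F F in finite_subsets_at_top ?M. fps_nth (sum ?f F) n = fps_nth ?S n"
      unfolding eventually_finite_subsets_at_top
    proof (intro exI conjI allI impI)
      show "finite {x \<in> ?M. trace_length x \<le> n}" by (rule fin)
      show "{x \<in> ?M. trace_length x \<le> n} \<subseteq> ?M" by auto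
      fix F assume F: "finite F \<and> {x \<in> ?M. trace_length x \<le> n} \<subseteq> F \<and> F \<subseteq> ?M"
      have "fps_nth (sum ?f F) n = (\<Sum>x\<in>F. if trace_length x = n then 1 else 0)"
        by (simp add: fps_sum_nth eq_commute)
      also have "\<dots> = int (card {x \<in> F. trace_length x = n})"
        using F by (simp add: sum.If_cases Int_def)
      also have "{x \<in> F. trace_length x = n} = {x \<in> ?M. trace_length x = n}"
        using F by auto
      finally show "fps_nth (sum ?f F) n = fps_nth ?S n" by simp
    qed
  qed
  then show ?thesis by (simp add: has_sum_def)
qed

end

theory Submission
  imports Defs "HOL-Algebra.Divisibility"
begin

text \<open>
  For \<open>z\<close> in \<open>\<M>\<^sub>\<alpha>\<^sub>,\<^sub>\<beta>\<close>, cancellativity gives a bijection between the factorisations \<open>z = c \<cdot> x\<close> with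
  \<open>c\<close> a clique and the cliques dividing \<open>z\<close> on the left. These are the products of arbitrary sets of
  possible first letters of \<open>z\<close>, so their alternating count vanishes unless \<open>z = 1\<close>. This gives
  \<open>\<mu> Z = 1\<close>. Since \<open>\<mu>\<close> has constant term \<open>1\<close> it can be cancelled on the left, and
  \<open>\<mu> (Z \<mu>) = \<mu>\<close> yields \<open>Z \<mu> = 1\<close>.
\<close>

section \<open>First letters and cancellation in trace monoids\<close>

text \<open>The first occurrence of \<open>a\<close> may be preceded only by letters independent of
  \<open>a\<close>; for symmetric \<open>I\<close> this says that \<open>a\<close> divides the trace
  on the left.\<close>

primrec first_letter :: "('a \<times> 'a) set \<Rightarrow> 'a \<Rightarrow> 'a list \<Rightarrow> bool" where
  "first_letter I a [] \<longleftrightarrow> False"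
| "first_letter I a (b # w) \<longleftrightarrow> b = a \<or> (b, a) \<in> I \<and> first_letter I a w"

lemma first_letter_append:
  "first_letter I a (u @ v) \<longleftrightarrow>
     first_letter I a u \<or> (\<forall>b\<in>set u. (b, a) \<in> I) \<and> first_letter I a v"
  by (induction u) auto

lemma first_letter_in_set: "first_letter I a w \<Longrightarrow> a \<in> set w"
  by (induction w) auto

lemma trace_cong_set: "(u, v) \<in> trace_cong I \<Longrightarrow> set u = set v"
  by (metis trace_cong_mset mset_eq_setD)

text \<open>Makes being a first letter a property of traces. Swapping two independent letters
  matters only if \<open>a\<close> is one of them; symmetry of \<open>I\<close> then lets
  \<open>a\<close> pass the other.\<close>

lemma first_letter_trace_cong:
  assumes "sym I" "(u, v) \<in> trace_cong I"
  shows "first_letter I a u \<longleftrightarrow> first_letter I a v"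
  using assms(2)
proof (induction rule: trace_cong.induct)
  case (commute b c)
  then show ?case using symD[OF assms(1)] by auto
next
  case (append u v u' v')
  then show ?case using trace_cong_set[OF append.hyps(1)] by (simp add: first_letter_append)
qed auto

text \<open>Congruent words have the same letters, so in a concatenation both sides lose
  \<open>a\<close> from the same factor. This is the source of cancellation.\<close>

lemma remove1_trace_cong:
  "(u, v) \<in> trace_cong I \<Longrightarrow> (remove1 a u, remove1 a v) \<in> trace_cong I"
proof (induction rule: trace_cong.induct)
  case (commute b c)
  then show ?case by (auto intro: trace_cong.intros)
next
  case (append u v u' v')
  then show ?case
    using trace_cong_set[OF append.hyps(1)] by (auto simp: remove1_append intro: trace_cong.append)
qed (auto intro: trace_cong.intros)

lemma trace_cong_Cons: "(u, v) \<in> trace_cong I \<Longrightarrow> (a # u, a # v) \<in> trace_cong I"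
  using trace_cong.append[OF trace_cong.refl[of "[a]"]] by fastforce

lemma trace_cong_swap: "(a, b) \<in> I \<Longrightarrow> (a # b # w, b # a # w) \<in> trace_cong I"
  using trace_cong.append[OF trace_cong.commute trace_cong.refl[of w]] by fastforce

text \<open>The letters of \<open>u\<close> can be deleted one after another, since each deletion
  respects the congruence.\<close>

lemma trace_cong_append_cancel:
  "(u @ v, u @ v') \<in> trace_cong I \<Longrightarrow> (v, v') \<in> trace_cong I"
proof (induction u)
  case (Cons a u)
  then show ?case using remove1_trace_cong[OF Cons.prems, of a] by simp
qed simp

lemma first_letter_remove1:
  "first_letter I a w \<Longrightarrow> (w, a # remove1 a w) \<in> trace_cong I"
proof (induction w)
  case (Cons b w)
  show ?case
  proof (cases "b = a")
    case False
    with Cons have "(b, a) \<in> I" "(w, a # remove1 a w) \<in> trace_cong I" by auto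
    with False show ?thesis
      using trace_cong.trans[OF trace_cong_Cons trace_cong_swap] by fastforce
  qed (auto intro: trace_cong.refl)
qed simp

text \<open>Whichever letter appears later commutes with everything before its first occurrence,
  hence with the other letter.\<close>

lemma first_letters_independent:
  assumes "sym I" "first_letter I a w" "first_letter I b w" "a \<noteq> b"
  shows "(a, b) \<in> I"
  using assms(2,3)
proof (induction w)
  case (Cons c w)
  then show ?case using assms(1,4) by (auto dest: symD)
qed simp

section \<open>Cliques dividing a trace\<close>

definition independent :: "('a \<times> 'a) set \<Rightarrow> 'a set \<Rightarrow> bool" where
  "independent I S \<longleftrightarrow> (\<forall>a\<in>S. \<forall>b\<in>S. a \<noteq> b \<longrightarrow> (a, b) \<in> I)"

text \<open>All letters of the clique \<open>u\<close> are first letters of \<open>u\<close>, hence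
  of its multiples; conversely they can be moved to the front of \<open>w\<close> one at a
  time.\<close>

lemma prefix_trace_cong_iff:
  assumes "sym I" "distinct u" "independent I (set u)"
  shows "(\<exists>v. (w, u @ v) \<in> trace_cong I) \<longleftrightarrow> (\<forall>a\<in>set u. first_letter I a w)"
proof
  assume "\<exists>v. (w, u @ v) \<in> trace_cong I"
  then obtain v where "(w, u @ v) \<in> trace_cong I" by blast
  moreover have "first_letter I a u" if "a \<in> set u" for a
    using that assms(2,3) by (induction u) (auto simp: independent_def)
  ultimately show "\<forall>a\<in>set u. first_letter I a w"
    using first_letter_trace_cong[OF assms(1)] by (metis first_letter_append)
next
  assume "\<forall>a\<in>set u. first_letter I a w"
  then show "\<exists>v. (w, u @ v) \<in> trace_cong I"
    using assms(2,3)
  proof (induction u arbitrary: w)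
    case Nil
    then show ?case using trace_cong.refl by auto
  next
    case (Cons a u)
    have w: "(w, a # remove1 a w) \<in> trace_cong I"
      using Cons.prems by (intro first_letter_remove1) simp
    \<comment> \<open>Distinctness gives \<open>b \<noteq> a\<close>, so \<open>b\<close> as a first
      letter of \<open>a # remove1 a w\<close> must come from the remainder.\<close>
    then have "\<forall>b\<in>set u. first_letter I b (remove1 a w)"
      using Cons.prems first_letter_trace_cong[OF assms(1) w] by fastforce
    then obtain v where "(remove1 a w, u @ v) \<in> trace_cong I"
      using Cons.IH[of "remove1 a w"] Cons.prems by (auto simp: independent_def)
    then show ?case
      using trace_cong.trans[OF w trace_cong_Cons] by auto
  qed
qed

text \<open>By the divisibility criterion \<open>u\<close> divides \<open>v\<close>, and equal
  lengths force the cofactor to be empty.\<close>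

lemma independent_trace_cong:
  assumes "sym I" "distinct u" "distinct v" "set u = set v" "independent I (set u)"
  shows "(u, v) \<in> trace_cong I"
proof -
  \<comment> \<open>The word \<open>v\<close> is its own prefix, with empty cofactor.\<close>
  have "first_letter I a v" if "a \<in> set v" for a
    using that assms(1,3,5) prefix_trace_cong_iff[of I v v] trace_cong.refl[of v I]
    by (metis append_Nil2 assms(4))
  then obtain x where x: "(v, u @ x) \<in> trace_cong I"
    using prefix_trace_cong_iff[OF assms(1,2,5), of v] assms(4) by blast
  have "length v = length u"
    using assms(2-4) by (metis distinct_card)
  then have "x = []"
    using trace_cong_mset[OF x, THEN mset_eq_length] by simp
  with x show ?thesis by (auto intro: trace_cong.sym)
qed

text \<open>\<open>SOME\<close> picks an arbitrary order of the letters; for finite independent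
  \<open>S\<close> and symmetric \<open>I\<close> every order gives the same trace.\<close>

definition set_trace :: "('a \<times> 'a) set \<Rightarrow> 'a set \<Rightarrow> 'a list set" where
  "set_trace I S = trace_of I (SOME w. distinct w \<and> set w = S)"

lemma set_traceE:
  assumes "finite S"
  obtains w where "distinct w" "set w = S" "set_trace I S = trace_of I w"
  using someI_ex[of "\<lambda>w. distinct w \<and> set w = S"] finite_distinct_list[OF assms]
  by (metis set_trace_def)

lemma trace_length_set_trace: "finite S \<Longrightarrow> trace_length (set_trace I S) = card S"
  by (metis set_traceE trace_length_trace_of distinct_card)

text \<open>First letters are pairwise independent, so any set of them forms a clique, and a clique
  divides exactly when its letters are first letters. Injectivity holds because a trace determines
  its letters.\<close>

lemma cliques_dividing_bij_betw:
  fixes I :: "('a \<times> 'a) set"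
  assumes "sym I"
  shows "bij_betw (set_trace I) (Pow {a. first_letter I a w})
    {c \<in> cliques I. c divides\<^bsub>trace_monoid I\<^esub> trace_of I w}"
    (is "bij_betw _ (Pow ?F) ?C")
proof -
  have fin: "finite S" if "S \<subseteq> ?F" for S
    by (rule finite_subset[of _ "set w"]) (use that in \<open>auto dest: first_letter_in_set\<close>)
  have indep: "independent I S" if "S \<subseteq> ?F" for S
    using that unfolding independent_def
    by (blast intro: first_letters_independent[OF assms])
  have divides: "trace_of I u divides\<^bsub>trace_monoid I\<^esub> trace_of I w \<longleftrightarrow> set u \<subseteq> ?F"
    if "distinct u" "independent I (set u)" for u
    using prefix_trace_cong_iff[OF assms that, of w]
    by (auto simp: factor_def carrier_trace_monoid mult_trace_of trace_of_eq_iff)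
  show ?thesis
  proof (rule bij_betw_imageI)
    show "inj_on (set_trace I) (Pow ?F)"
    proof (rule inj_onI)
      fix S T assume ST: "S \<in> Pow ?F" "T \<in> Pow ?F" "set_trace I S = set_trace I T"
      obtain u where "set u = S" "set_trace I S = trace_of I u"
        using set_traceE fin ST by (metis PowD)
      moreover obtain v where "set v = T" "set_trace I T = trace_of I v"
        using set_traceE fin ST by (metis PowD)
      ultimately show "S = T"
        using ST(3) trace_cong_set by (metis trace_of_eq_iff)
    qed
    show "set_trace I ` Pow ?F = ?C"
    proof (intro subset_antisym subsetI)
      fix c assume "c \<in> set_trace I ` Pow ?F"
      then obtain S where S: "S \<subseteq> ?F" "c = set_trace I S" by blast
      obtain u where u: "distinct u" "set u = S" "c = trace_of I u"
        using set_traceE[OF fin[OF S(1)]] S(2) by metis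
      with indep[OF S(1)] have "c \<in> cliques I"
        by (auto simp: cliques_def independent_def)
      with u S(1) indep[OF S(1)] show "c \<in> ?C"
        using divides[of u] by simp
    next
      fix c assume c: "c \<in> ?C"
      then obtain u where u: "c = trace_of I u" "distinct u" "independent I (set u)"
        by (auto simp: cliques_def independent_def)
      with c have F: "set u \<subseteq> ?F"
        using divides[of u] by simp
      obtain v where v: "distinct v" "set v = set u" "set_trace I (set u) = trace_of I v"
        using set_traceE[OF fin[OF F]] by metis
      then have "c = set_trace I (set u)"
        using u independent_trace_cong[OF assms] by (metis trace_of_eq_iff)
      with F show "c \<in> set_trace I ` Pow ?F" by blast
    qed
  qed
qed

text \<open>Expand the product of the factors \<open>1 - 1\<close> over \<open>A\<close>; only the
  empty product survives.\<close>

lemma sum_Pow_minus_one_power_card: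
  assumes "finite A"
  shows "(\<Sum>S\<in>Pow A. (- 1) ^ card S) = (if A = {} then 1 else (0 :: 'b::comm_ring_1))"
  using prod_diff_conv_sum[OF assms, of "\<lambda>_. 1 :: 'b" "\<lambda>_. 1"] assms by (simp add: power_0_left)

text \<open>Cartier-Foata inversion, read off at the single trace \<open>z\<close>.\<close>

lemma sum_cliques_dividing:
  assumes "sym I" "z \<in> carrier (trace_monoid I)"
  shows "(\<Sum>c | c \<in> cliques I \<and> c divides\<^bsub>trace_monoid I\<^esub> z. (- 1) ^ trace_length c)
    = (if z = \<one>\<^bsub>trace_monoid I\<^esub> then 1 else (0 :: 'b::comm_ring_1))"
proof -
  obtain w where w: "z = trace_of I w"
    using assms(2) by (auto simp: carrier_trace_monoid)
  define F where "F = {a. first_letter I a w}"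
  have fin: "finite F"
    by (rule finite_subset[of _ "set w"]) (auto simp: F_def dest: first_letter_in_set)
  have "(\<Sum>c | c \<in> cliques I \<and> c divides\<^bsub>trace_monoid I\<^esub> z. (- 1) ^ trace_length c)
      = (\<Sum>S\<in>Pow F. (- 1 :: 'b) ^ trace_length (set_trace I S))"
    unfolding w F_def
    by (rule sum.reindex_bij_betw[OF cliques_dividing_bij_betw[OF assms(1), of w], symmetric])
  also have "\<dots> = (\<Sum>S\<in>Pow F. (- 1) ^ card S)"
    using fin by (intro sum.cong) (auto simp: trace_length_set_trace finite_subset)
  also have "\<dots> = (if F = {} then 1 else 0)"
    by (rule sum_Pow_minus_one_power_card[OF fin])
  \<comment> \<open>The head of a nonempty word is one of its first letters.\<close>
  also have "F = {} \<longleftrightarrow> w = []"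
    by (cases w) (auto simp: F_def)
  also have "w = [] \<longleftrightarrow> z = \<one>\<^bsub>trace_monoid I\<^esub>"
    using trace_cong_set[of w "[]" I] trace_cong.refl by (auto simp: w one_trace_monoid trace_of_eq_iff)
  finally show ?thesis .
qed

section \<open>Matrices of formal power series\<close>

text \<open>As the constant term of \<open>A\<close> is the identity matrix, coefficient
  \<open>n\<close> of \<open>A ** M\<close> is that of \<open>M\<close> plus terms in lower
  coefficients of \<open>M\<close>, which strong induction controls.\<close>

lemma matrix_mult_left_cancel_fps:
  fixes A B C :: "'b::comm_ring_1 fps ^ 'n::finite ^ 'n"
  assumes eq: "A ** B = A ** C"
    and A: "\<And>i j. fps_nth (A $ i $ j) 0 = (if i = j then 1 else 0)"
  shows "B = C"
proof -
  have "fps_nth (B $ i $ j) n = fps_nth (C $ i $ j) n" for i j n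
  \<comment> \<open>The row index stays general because the convolution involves every row
    \<open>k\<close>.\<close>
  proof (induction n arbitrary: i rule: less_induct)
    case (less n)
    have split: "fps_nth ((A ** M) $ i $ j) n =
        fps_nth (M $ i $ j) n +
          (\<Sum>k\<in>UNIV. \<Sum>l=1..n. fps_nth (A $ i $ k) l * fps_nth (M $ k $ j) (n - l))"
      for M :: "'b fps ^ 'n ^ 'n"
    proof -
      have "fps_nth ((A ** M) $ i $ j) n =
          (\<Sum>k\<in>UNIV. \<Sum>l=0..n. fps_nth (A $ i $ k) l * fps_nth (M $ k $ j) (n - l))"
        by (simp add: matrix_matrix_mult_def fps_sum_nth fps_mult_nth)
      also have "\<dots> = (\<Sum>k\<in>UNIV. (if i = k then fps_nth (M $ k $ j) n else 0) +
          (\<Sum>l=1..n. fps_nth (A $ i $ k) l * fps_nth (M $ k $ j) (n - l)))"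
        by (intro sum.cong) (auto simp: sum.atLeast_Suc_atMost A)
      finally show ?thesis by (simp add: sum.distrib)
    qed
    have "(\<Sum>k\<in>UNIV. \<Sum>l=1..n. fps_nth (A $ i $ k) l * fps_nth (B $ k $ j) (n - l)) =
        (\<Sum>k\<in>UNIV. \<Sum>l=1..n. fps_nth (A $ i $ k) l * fps_nth (C $ k $ j) (n - l))"
      by (intro sum.cong HOL.refl) (simp add: less.IH)
    with split[of B] split[of C] eq show ?case by simp
  qed
  then show ?thesis by (simp add: vec_eq_iff fps_eq_iff)
qed

section \<open>Coefficients of the product of the Moebius and growth matrices\<close>

lemma fps_nth_growth_matrix:
  fixes I :: "('a::finite \<times> 'a) set"
  shows "fps_nth (growth_matrix I En act $ \<alpha> $ \<beta>) n =
    int (card {x \<in> traces_between I En act \<alpha> \<beta>. trace_length x = n})"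
  by (simp add: growth_matrix_def infsumI[OF growth_series_has_sum])

text \<open>Left multiplication by \<open>c\<close> is injective by cancellation and turns paths
  from \<gamma> into paths from \<alpha>. The guard matters because subtraction truncates: a longer
  \<open>c\<close> has no multiple of length \<open>n\<close>.\<close>

lemma card_cofactors:
  assumes I: "irrefl I" "sym I" and pa: "partial_action I En act"
    and c: "c \<in> traces_between I En act \<alpha> \<gamma>"
  shows "card {z \<in> traces_between I En act \<alpha> \<beta>. trace_length z = n \<and> c divides\<^bsub>trace_monoid I\<^esub> z} =
    (if trace_length c \<le> n
     then card {x \<in> traces_between I En act \<gamma> \<beta>. trace_length x = n - trace_length c} else 0)"
    (is "card ?Z = _")
proof -
  obtain u where u: "c = trace_of I u" and \<gamma>: "foldl (total_step En act) (Some \<alpha>) u = Some \<gamma>"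
    using c by (auto simp: traces_between_def carrier_trace_monoid total_action_trace_of[OF I pa])
  note simps = traces_between_def carrier_trace_monoid total_action_trace_of[OF I pa]
    factor_def mult_trace_of trace_length_trace_of u \<gamma>
  show ?thesis
  proof (cases "trace_length c \<le> n")
    case True
    let ?X = "{x \<in> traces_between I En act \<gamma> \<beta>. trace_length x = n - trace_length c}"
    have "inj_on (\<lambda>x. c \<otimes>\<^bsub>trace_monoid I\<^esub> x) ?X"
      by (auto simp: inj_on_def simps trace_of_eq_iff
          intro!: trace_of_eq_iff[THEN iffD2] dest: trace_cong_append_cancel)
    moreover have "(\<lambda>x. c \<otimes>\<^bsub>trace_monoid I\<^esub> x) ` ?X = ?Z"
      using True by (force simp: simps)
    ultimately show ?thesis
      using True card_image by fastforce
  next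
    case False
    then have "?Z = {}" by (auto simp: simps)
    with False show ?thesis by (metis card.empty)
  qed
qed

text \<open>Writes the sign as a constant series, so that it can be pulled out of
  coefficients.\<close>

lemma minus_one_power_fps: "(- 1 :: 'b::comm_ring_1 fps) ^ n * f = fps_const ((- 1) ^ n) * f"
  by (simp flip: fps_const_power fps_const_neg)

text \<open>Signed double counting, in each degree \<open>n\<close>, of the pairs of a clique and a
  multiple of it leading from \<alpha> to \<beta>.\<close>

lemma moebius_growth:
  fixes I :: "('a::finite \<times> 'a) set" and En :: "'x::finite \<Rightarrow> 'a set"
  assumes I: "irrefl I" "sym I" and pa: "partial_action I En act"
  shows "moebius_matrix I En act ** growth_matrix I En act = mat 1"
proof -
  let ?M = "traces_between I En act"
  have "fps_nth ((moebius_matrix I En act ** growth_matrix I En act) $ \<alpha> $ \<beta>) n =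
      (if \<alpha> = \<beta> \<and> n = 0 then 1 else 0)" for \<alpha> \<beta> n
  proof -
    define Z where "Z = {z \<in> ?M \<alpha> \<beta>. trace_length z = n}"
    have finZ: "finite Z"
      by (rule finite_subset[OF _ finite_traces_of_length[of I n]])
        (auto simp: Z_def traces_between_def)
    let ?D = "\<lambda>c. {z \<in> Z. c divides\<^bsub>trace_monoid I\<^esub> z}"
    have "fps_nth ((moebius_matrix I En act ** growth_matrix I En act) $ \<alpha> $ \<beta>) n =
        (\<Sum>\<gamma>\<in>UNIV. \<Sum>c\<in>cliques I \<inter> ?M \<alpha> \<gamma>. (- 1) ^ trace_length c *
          fps_nth (fps_X ^ trace_length c * growth_matrix I En act $ \<gamma> $ \<beta>) n)"
      by (simp add: matrix_matrix_mult_def moebius_matrix_def fps_sum_nth sum_distrib_right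
          minus_one_power_fps mult.assoc)
    \<comment> \<open>Counting multiples of \<open>c\<close> in \<open>Z\<close> instead of
      cofactors removes \<gamma> from the summand.\<close>
    also have "\<dots> = (\<Sum>\<gamma>\<in>UNIV. \<Sum>c\<in>cliques I \<inter> ?M \<alpha> \<gamma>.
        (- 1) ^ trace_length c * int (card (?D c)))"
    proof (intro sum.cong HOL.refl)
      fix \<gamma> c assume "c \<in> cliques I \<inter> ?M \<alpha> \<gamma>"
      then show "(- 1) ^ trace_length c *
          fps_nth (fps_X ^ trace_length c * growth_matrix I En act $ \<gamma> $ \<beta>) n =
        (- 1) ^ trace_length c * int (card (?D c))"
        using card_cofactors[OF I pa, of c \<alpha> \<gamma> \<beta> n]
        by (auto simp: fps_X_power_mult_nth fps_nth_growth_matrix Z_def conj_ac)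
    qed
    \<comment> \<open>A clique sends \<alpha> to at most one \<gamma>, so the union is
      disjoint.\<close>
    also have "\<dots> = (\<Sum>c\<in>(\<Union>\<gamma>. cliques I \<inter> ?M \<alpha> \<gamma>). (- 1) ^ trace_length c * int (card (?D c)))"
      by (rule sum.UNION_disjoint[symmetric])
        (auto simp: finite_cliques traces_between_def)
    also have "\<dots> = (\<Sum>c\<in>cliques I. (- 1) ^ trace_length c * int (card (?D c)))"
    proof (rule sum.mono_neutral_left)
      \<comment> \<open>A clique outside the union sends \<alpha> to the absorbing point
        \<open>None\<close>, so none of its multiples reaches \<beta>.\<close>
      have "?D c = {}" if "c \<in> cliques I - (\<Union>\<gamma>. cliques I \<inter> ?M \<alpha> \<gamma>)" for c
      proof -
        have c: "c \<in> carrier (trace_monoid I)"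
          using that by (auto simp: cliques_def carrier_trace_monoid)
        with that have bot: "total_action En act (Some \<alpha>) c = None"
          by (cases "total_action En act (Some \<alpha>) c") (auto simp: traces_between_def)
        have None: "total_action En act None x = None" if "x \<in> carrier (trace_monoid I)" for x
        proof -
          have "foldl (total_step En act) None w = None" for w
            by (induction w) (simp_all add: total_step_def)
          with that show ?thesis
            by (auto simp: carrier_trace_monoid total_action_trace_of[OF I pa])
        qed
        show ?thesis
          using bot None c
          by (auto simp: Z_def traces_between_def factor_def total_action_right_action(2)[OF I pa])
      qed
      then show "\<forall>c\<in>cliques I - (\<Union>\<gamma>. cliques I \<inter> ?M \<alpha> \<gamma>).
          (- 1) ^ trace_length c * int (card (?D c)) = 0"
        by (simp del: Collect_empty_eq)
    qed (auto simp: finite_cliques)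
    also have "\<dots> = (\<Sum>c\<in>cliques I. \<Sum>z\<in>?D c. (- 1) ^ trace_length c)"
      by (simp add: mult.commute)
    also have "\<dots> = (\<Sum>z\<in>Z. \<Sum>c | c \<in> cliques I \<and> c divides\<^bsub>trace_monoid I\<^esub> z. (- 1) ^ trace_length c)"
      by (rule sum.swap_restrict[OF finite_cliques finZ])
    also have "\<dots> = (\<Sum>z\<in>Z. if z = \<one>\<^bsub>trace_monoid I\<^esub> then 1 else 0)"
      by (intro sum.cong HOL.refl sum_cliques_dividing I) (auto simp: Z_def traces_between_def)
    also have "\<dots> = (if \<one>\<^bsub>trace_monoid I\<^esub> \<in> Z then 1 else 0)"
      using finZ by simp
    \<comment> \<open>The empty trace fixes every point and has length 0.\<close>
    also have "\<one>\<^bsub>trace_monoid I\<^esub> \<in> Z \<longleftrightarrow> \<alpha> = \<beta> \<and> n = 0"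
      by (auto simp: Z_def traces_between_def carrier_trace_monoid one_trace_monoid
          total_action_trace_of[OF I pa] trace_length_trace_of)
    finally show ?thesis .
  qed
  then show ?thesis
    by (simp add: vec_eq_iff fps_eq_iff mat_def)
qed

text \<open>Only the empty clique has length 0, and it fixes every point. This is the condition for
  cancelling the Moebius matrix on the left.\<close>

lemma fps_nth_0_moebius_matrix:
  fixes I :: "('a::finite \<times> 'a) set" and En :: "'x::finite \<Rightarrow> 'a set"
  assumes I: "irrefl I" "sym I" and pa: "partial_action I En act"
  shows "fps_nth (moebius_matrix I En act $ \<alpha> $ \<beta>) 0 = (if \<alpha> = \<beta> then 1 else 0)"
proof -
  have one: "trace_of I [] \<in> cliques I"
    by (auto simp: cliques_def)
  have eq1: "c \<in> cliques I \<Longrightarrow> trace_length c = 0 \<longleftrightarrow> c = trace_of I []" for c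
    by (auto simp: cliques_def trace_length_trace_of)
  have "fps_nth (moebius_matrix I En act $ \<alpha> $ \<beta>) 0 =
      (\<Sum>c\<in>cliques I \<inter> traces_between I En act \<alpha> \<beta>. if c = trace_of I [] then 1 else 0)"
    unfolding moebius_matrix_def fps_sum_nth vec_lambda_beta
    by (intro sum.cong) (auto simp: fps_mult_nth_0 fps_nth_power_0 eq1 trace_length_trace_of)
  also have "\<dots> = (if trace_of I [] \<in> traces_between I En act \<alpha> \<beta> then 1 else 0)"
    by (simp add: finite_cliques one)
  finally show ?thesis
    by (simp add: traces_between_def carrier_trace_monoid total_action_trace_of[OF I pa])
qed

theorem theorem4:
  fixes I :: "('a::finite \<times> 'a) set"
    and En :: "'x::finite \<Rightarrow> 'a set"
    and act :: "'x \<Rightarrow> 'a \<Rightarrow> 'x"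
  assumes "CARD('a) \<ge> 2"
    and "irrefl I"
    and "sym I"
    and "partial_action I En act"
  shows "moebius_matrix I En act ** growth_matrix I En act = mat 1 \<and>
         growth_matrix I En act ** moebius_matrix I En act = mat 1"
proof
  let ?\<mu> = "moebius_matrix I En act" and ?Z = "growth_matrix I En act"
  show \<mu>Z: "?\<mu> ** ?Z = mat 1"
    using assms(2-4) by (rule moebius_growth)
  have "?\<mu> ** (?Z ** ?\<mu>) = ?\<mu> ** mat 1"
    by (simp add: matrix_mul_assoc \<mu>Z)
  then show "?Z ** ?\<mu> = mat 1"
    by (rule matrix_mult_left_cancel_fps) (rule fps_nth_0_moebius_matrix[OF assms(2-4)])
qed

end
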